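(* Let $q\ge 1$, let $F,G:\mathbb{R}^n\to\mathbb{R}$ be $C^q$ functions and let $f:\mathbb{R}^{2n}\to\mathbb{R}^n$ be a $C^q$ function, such that the vector fields $x\mapsto f(x,\nabla F(x))$ and $x\mapsto f(x,\nabla G(x))$ are of class $C^1$. Consider the differential equations $$\text{(I)}\quad \dot x=f(x,\nabla F(x)),\qquad \text{(II)}\quad \dot x=f(x,\nabla G(x)),$$ and let $\Phi^F_t(x)$ and $\Phi^G_t(x)$ be the solutions of (I) and (II), respectively, with $\Phi^F_0(x)=x$ and $\Phi^G_0(x)=x$. Let $$E_1=\{x\in\mathbb{R}^n\mid \nabla F(x)=\nabla G(x)\}.$$ If $F-G$ is a conserved quantity for (I) and $x\in E_1$, then $\Phi^F_t(x)=\Phi^G_t(x)$ for all $t$.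
   Context: A function $L:\mathbb{R}^n\to\mathbb{R}$ is a conserved quantity for a differential equation if it is constant along each of its solutions. "For all $t$" means for all $t$ in the (maximal) interval of existence of the solutions. *)

theory Defs
  imports "HOL-Analysis.Analysis"
begin

(* Class C^k on the whole space. Derivatives are iterated through the directional
   derivatives x \<mapsto> Df(x) v, so that the type does not change in the recursion; on a
   finite-dimensional domain this is the usual notion (k-th derivative exists and is
   continuous). *)
fun C_class :: "nat \<Rightarrow> ('a::euclidean_space \<Rightarrow> 'b::real_normed_vector) \<Rightarrow> bool" where
  "C_class 0 f \<longleftrightarrow> continuous_on UNIV f"
| "C_class (Suc k) f \<longleftrightarrow>
     (\<forall>x. f differentiable (at x)) \<and>
     (\<forall>v. C_class k (\<lambda>x. frechet_derivative f (at x) v))"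

(* Unspecified at points where F is not differentiable. *)
definition gradient :: "('a::real_inner \<Rightarrow> real) \<Rightarrow> 'a \<Rightarrow> 'a" where
  "gradient F x = (THE D. GDERIV F x :> D)"

(* Only the values of \<phi> on the open, possibly unbounded, interval J matter. *)
definition ode_solution ::
    "('a::real_normed_vector \<Rightarrow> 'a) \<Rightarrow> real set \<Rightarrow> (real \<Rightarrow> 'a) \<Rightarrow> bool" where
  "ode_solution v J \<phi> \<longleftrightarrow>
     open J \<and> is_interval J \<and> (\<forall>t\<in>J. (\<phi> has_vector_derivative v (\<phi> t)) (at t))"

definition maximal_solution ::
    "('a::real_normed_vector \<Rightarrow> 'a) \<Rightarrow> 'a \<Rightarrow> real set \<Rightarrow> (real \<Rightarrow> 'a) \<Rightarrow> bool" where
  "maximal_solution v x J \<phi> \<longleftrightarrow>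
     ode_solution v J \<phi> \<and> 0 \<in> J \<and> \<phi> 0 = x \<and>
     (\<forall>K \<psi>. ode_solution v K \<psi> \<and> J \<subseteq> K \<and> (\<forall>t\<in>J. \<psi> t = \<phi> t) \<longrightarrow> K = J)"

definition conserved_quantity ::
    "('a::real_normed_vector \<Rightarrow> 'a) \<Rightarrow> ('a \<Rightarrow> real) \<Rightarrow> bool" where
  "conserved_quantity v L \<longleftrightarrow>
     (\<forall>J \<phi>. ode_solution v J \<phi> \<longrightarrow> (\<forall>s\<in>J. \<forall>t\<in>J. L (\<phi> s) = L (\<phi> t)))"

end

theory Submission
  imports Defs
begin

text \<open>
  Put \<open>L = F - G\<close>, so that \<open>E\<^sub>1\<close> is the set of critical points of \<open>L\<close>. The heart of the matter
  is that the critical points of a conserved quantity of a \<open>C\<^sup>1\<close> vector field form an invariant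
  set (\<open>critical_point_transport\<close>). The textbook argument differentiates \<open>L(\<Phi>\<^sub>t(y)) = L(y)\<close> in
  \<open>y\<close> and uses that \<open>D\<Phi>\<^sub>t(y)\<close> is invertible. Differentiability of the flow can be avoided,
  because only the vanishing of a derivative has to be transported: if \<open>b = \<Phi>\<^sub>\<tau>(a)\<close>, the
  backward flow carries \<open>b + h\<close> to a point \<open>a + k\<close> with \<open>|k| \<le> C|h|\<close>, whence
  \<open>L(b + h) - L(b) = L(a + k) - L(a) = o(|k|) = o(|h|)\<close> as soon as \<open>a\<close> is critical. This needs
  just two facts on the flow: solutions exist near a point for a uniform time
  (\<open>locally_uniform_existence\<close>) and depend on their initial value in a Lipschitz way
  (\<open>solution_distance_le\<close>). It gives the statement for short times, and connectedness of the
  time interval does the rest.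

  Consequently \<open>\<nabla>F = \<nabla>G\<close> along \<open>\<Phi>\<^sup>F(x)\<close> if \<open>x \<in> E\<^sub>1\<close>, so \<open>\<Phi>\<^sup>F(x)\<close> solves (II) as well. By
  uniqueness it agrees with \<open>\<Phi>\<^sup>G(x)\<close> on the common interval, and its interval is contained in that
  of \<open>\<Phi>\<^sup>G(x)\<close> by maximality of the latter. Conversely, if the interval of \<open>\<Phi>\<^sup>F(x)\<close> ended
  inside that of \<open>\<Phi>\<^sup>G(x)\<close>, then \<open>\<Phi>\<^sup>F(x)\<close> would converge to a point at its end, and a maximal
  solution never does that (\<open>maximal_solution_no_escape\<close>).
\<close>

section \<open>Lipschitz dependence on initial values\<close>

lemma C_class_1_has_derivative:
  assumes "C_class 1 v"
  shows "(v has_derivative frechet_derivative v (at x)) (at x)"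
  using assms by (simp add: frechet_derivative_works[symmetric])

text \<open>
  The mean value inequality, with the operator norm of the derivative controlled by its values on
  the basis: these are the continuous directional derivatives that the notion of class \<open>C\<^sup>1\<close>
  used here provides.
\<close>

lemma C_class_1_lipschitz_on:
  fixes v :: "'a::euclidean_space \<Rightarrow> 'b::real_normed_vector"
  assumes v: "C_class 1 v" and "compact S" "convex S"
  obtains K where "K-lipschitz_on S v"
proof -
  define B where "B x = (\<Sum>b\<in>Basis. norm (frechet_derivative v (at x) b))" for x
  have "continuous_on S B"
    unfolding B_def using v by (auto intro!: continuous_intros intro: continuous_on_subset)
  then have "bounded (B ` S)"
    using \<open>compact S\<close> by (intro compact_imp_bounded compact_continuous_image)
  then obtain K where K: "K > 0" "\<And>x. x \<in> S \<Longrightarrow> norm (B x) \<le> K"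
    by (auto simp: bounded_pos)
  have "K-lipschitz_on S v"
  proof (rule lipschitz_onI)
    fix x y assume "x \<in> S" "y \<in> S"
    then show "dist (v x) (v y) \<le> K * dist x y"
      unfolding dist_norm
    proof (rule differentiable_bound[OF \<open>convex S\<close>, rotated 2])
      fix x assume x: "x \<in> S"
      have d: "(v has_derivative frechet_derivative v (at x)) (at x)"
        by (rule C_class_1_has_derivative[OF v])
      then show "(v has_derivative frechet_derivative v (at x)) (at x within S)"
        by (rule has_derivative_at_withinI)
      have "onorm (frechet_derivative v (at x)) \<le> B x"
        unfolding B_def by (rule onorm_componentwise) (rule has_derivative_bounded_linear[OF d])
      also have "\<dots> \<le> K"
        using K(2)[OF x] by simp
      finally show "onorm (frechet_derivative v (at x)) \<le> K" .
    qed
  qed (use K in simp)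
  then show thesis by (rule that)
qed

text \<open>
  Gronwall's estimate, forward and backward in time. The squared distance \<open>D\<close> of two solutions
  satisfies \<open>|D'| \<le> 2KD\<close> by the Cauchy-Schwarz inequality, so \<open>D(\<tau>) exp(-2K(\<tau> - s))\<close> decreases
  and \<open>D(\<tau>) exp(2K(\<tau> - s))\<close> increases. The square is used because the norm itself need not be
  differentiable where the solutions meet.
\<close>

lemma solution_distance_le:
  fixes v :: "'a::real_inner \<Rightarrow> 'a"
  assumes lip: "K-lipschitz_on X v" and T: "is_interval T"
    and \<phi>: "\<And>t. t \<in> T \<Longrightarrow> (\<phi> has_vector_derivative v (\<phi> t)) (at t)" "\<And>t. t \<in> T \<Longrightarrow> \<phi> t \<in> X"
    and \<psi>: "\<And>t. t \<in> T \<Longrightarrow> (\<psi> has_vector_derivative v (\<psi> t)) (at t)" "\<And>t. t \<in> T \<Longrightarrow> \<psi> t \<in> X"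
    and "s \<in> T" "t \<in> T"
  shows "norm (\<phi> t - \<psi> t) \<le> exp (K * \<bar>t - s\<bar>) * norm (\<phi> s - \<psi> s)"
proof -
  define D where "D \<tau> = (\<phi> \<tau> - \<psi> \<tau>) \<bullet> (\<phi> \<tau> - \<psi> \<tau>)" for \<tau>
  define D' where "D' \<tau> = 2 * ((\<phi> \<tau> - \<psi> \<tau>) \<bullet> (v (\<phi> \<tau>) - v (\<psi> \<tau>)))" for \<tau>
  have D: "(D has_real_derivative D' \<tau>) (at \<tau>)" if "\<tau> \<in> T" for \<tau>
    unfolding D_def D'_def has_real_derivative_iff_has_vector_derivative has_vector_derivative_def
    using \<phi>(1)[OF that] \<psi>(1)[OF that] unfolding has_vector_derivative_def
    by (auto intro!: derivative_eq_intros simp: fun_eq_iff inner_commute algebra_simps)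
  have D'_le: "\<bar>D' \<tau>\<bar> \<le> 2 * K * D \<tau>" if "\<tau> \<in> T" for \<tau>
  proof -
    let ?n = "norm (\<phi> \<tau> - \<psi> \<tau>)"
    have "\<bar>(\<phi> \<tau> - \<psi> \<tau>) \<bullet> (v (\<phi> \<tau>) - v (\<psi> \<tau>))\<bar> \<le> ?n * norm (v (\<phi> \<tau>) - v (\<psi> \<tau>))"
      by (rule Cauchy_Schwarz_ineq2)
    also have "\<dots> \<le> ?n * (K * ?n)"
      using lipschitz_onD[OF lip \<phi>(2)[OF that] \<psi>(2)[OF that]]
      by (intro mult_left_mono) (auto simp: dist_norm)
    finally show ?thesis
      by (simp add: D'_def D_def dot_square_norm power2_eq_square abs_mult algebra_simps)
  qed
  have move: "a \<le> exp c * b" if "a * exp (- c) \<le> b" for a b c :: real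
    using that by (simp add: exp_minus field_simps)
  have "D t \<le> exp (2 * K * \<bar>t - s\<bar>) * D s"
  proof (cases "s \<le> t")
    case True
    have *: "\<tau> \<in> T" if "s \<le> \<tau>" "\<tau> \<le> t" for \<tau>
      using mem_is_interval_1_I[OF T _ _ that] assms(7,8) by blast
    have "D t * exp (- (2 * K * (t - s))) \<le> D s * exp (- (2 * K * (s - s)))"
    proof (rule DERIV_nonpos_imp_nonincreasing[OF True, where f = "\<lambda>\<tau>. D \<tau> * exp (- (2 * K * (\<tau> - s)))"])
      fix \<tau> assume \<tau>: "s \<le> \<tau>" "\<tau> \<le> t"
      have "((\<lambda>\<tau>. D \<tau> * exp (- (2 * K * (\<tau> - s)))) has_real_derivative
          (D' \<tau> - 2 * K * D \<tau>) * exp (- (2 * K * (\<tau> - s)))) (at \<tau>)"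
        using D[OF *[OF \<tau>]] by (auto intro!: derivative_eq_intros simp: algebra_simps)
      moreover have "(D' \<tau> - 2 * K * D \<tau>) * exp (- (2 * K * (\<tau> - s))) \<le> 0"
        using D'_le[OF *[OF \<tau>]] by (intro mult_nonpos_nonneg) auto
      ultimately show "\<exists>y. ((\<lambda>\<tau>. D \<tau> * exp (- (2 * K * (\<tau> - s)))) has_real_derivative y) (at \<tau>) \<and> y \<le> 0"
        by blast
    qed
    then show ?thesis
      using True move[of "D t" "2 * K * (t - s)"] by simp
  next
    case False
    have *: "\<tau> \<in> T" if "t \<le> \<tau>" "\<tau> \<le> s" for \<tau>
      using mem_is_interval_1_I[OF T _ _ that] assms(7,8) by blast
    have "D t * exp (2 * K * (t - s)) \<le> D s * exp (2 * K * (s - s))"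
    proof (rule DERIV_nonneg_imp_nondecreasing[where f = "\<lambda>\<tau>. D \<tau> * exp (2 * K * (\<tau> - s))"])
      fix \<tau> assume \<tau>: "t \<le> \<tau>" "\<tau> \<le> s"
      have "((\<lambda>\<tau>. D \<tau> * exp (2 * K * (\<tau> - s))) has_real_derivative
          (D' \<tau> + 2 * K * D \<tau>) * exp (2 * K * (\<tau> - s))) (at \<tau>)"
        using D[OF *[OF \<tau>]] by (auto intro!: derivative_eq_intros simp: algebra_simps)
      moreover have "(D' \<tau> + 2 * K * D \<tau>) * exp (2 * K * (\<tau> - s)) \<ge> 0"
        using D'_le[OF *[OF \<tau>]] by (intro mult_nonneg_nonneg) auto
      ultimately show "\<exists>y. ((\<lambda>\<tau>. D \<tau> * exp (2 * K * (\<tau> - s))) has_real_derivative y) (at \<tau>) \<and> y \<ge> 0"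
        by blast
    qed (use False in simp)
    then show ?thesis
      using False move[of "D t" "2 * K * (s - t)"] by (simp flip: mult_minus_right)
  qed
  also have "\<dots> = (exp (K * \<bar>t - s\<bar>) * norm (\<phi> s - \<psi> s))\<^sup>2"
    by (simp add: D_def dot_square_norm power_mult_distrib exp_double[symmetric] mult.assoc)
  finally have "(norm (\<phi> t - \<psi> t))\<^sup>2 \<le> (exp (K * \<bar>t - s\<bar>) * norm (\<phi> s - \<psi> s))\<^sup>2"
    by (simp add: D_def dot_square_norm)
  then show ?thesis
    by (rule power2_le_imp_le) simp
qed

section \<open>Local existence\<close>

text \<open>
  Picard's theorem: the integral equation has a solution because its right-hand side is a
  contraction of the bounded continuous functions with the supremum metric. Asking for a globally
  Lipschitz right-hand side spares any care about the domain of the iteration.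
\<close>

lemma picard_global_lipschitz:
  fixes w :: "'a::euclidean_space \<Rightarrow> 'a"
  assumes lip: "K-lipschitz_on UNIV w" and \<delta>: "\<delta> > 0" "K * \<delta> < 1"
  obtains \<phi> where "\<phi> 0 = z" "\<And>t. t \<in> {-\<delta><..<\<delta>} \<Longrightarrow> (\<phi> has_vector_derivative w (\<phi> t)) (at t)"
proof -
  have K: "K \<ge> 0"
    using lip by (rule lipschitz_on_nonneg)
  \<comment> \<open>the oriented integral from \<open>0\<close> to \<open>t\<close>, for \<open>t\<close> of either sign\<close>
  define I where "I h t = integral {-\<delta>..t} h - integral {-\<delta>..0} h" for h :: "real \<Rightarrow> 'a" and t
  have I: "(I h has_vector_derivative h t) (at t within {-\<delta>..\<delta>})"
    if "continuous_on {-\<delta>..\<delta>} h" "t \<in> {-\<delta>..\<delta>}" for h t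
    unfolding I_def using integral_has_vector_derivative[OF that]
    by (auto intro!: derivative_eq_intros)
  have w: "continuous_on {-\<delta>..\<delta>} (\<lambda>t. w (apply_bcontfun g t))" for g
    by (rule continuous_on_compose2[OF lipschitz_on_continuous_on[OF lip]]) auto
  \<comment> \<open>clamping the time turns the Picard operator into one on functions defined on the whole line\<close>
  have "\<exists>h. \<forall>t. apply_bcontfun h t = z + I (\<lambda>t. w (apply_bcontfun g t)) (clamp (-\<delta>) \<delta> t)"
    for g :: "real \<Rightarrow>\<^sub>C 'a"
  proof -
    have "continuous_on (cbox (-\<delta>) \<delta>) (\<lambda>t. z + I (\<lambda>t. w (apply_bcontfun g t)) t)"
      unfolding cbox_interval
      by (intro continuous_intros continuous_on_vector_derivative[OF I[OF w]])
    then show ?thesis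
      by (rule continuous_on_cbox_bcontfunE) blast
  qed
  then obtain P :: "(real \<Rightarrow>\<^sub>C 'a) \<Rightarrow> (real \<Rightarrow>\<^sub>C 'a)"
    where P: "\<And>g t. P g t = z + I (\<lambda>t. w (apply_bcontfun g t)) (clamp (-\<delta>) \<delta> t)"
    by metis
  have "dist (P g) (P h) \<le> (K * \<delta>) * dist g h" for g h
  proof (rule dist_bound)
    fix t
    define c where "c = clamp (-\<delta>) \<delta> t"
    have c: "c \<in> {-\<delta>..\<delta>}"
      using clamp_in_interval[of "-\<delta>" \<delta> t] \<delta> by (simp add: c_def)
    let ?d = "\<lambda>t. I (\<lambda>t. w (apply_bcontfun g t)) t - I (\<lambda>t. w (apply_bcontfun h t)) t"
    have "norm (?d c - ?d 0) \<le> (K * dist g h) * norm (c - 0)"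
    proof (rule differentiable_bound[of "{-\<delta>..\<delta>}"])
      fix t assume t: "t \<in> {-\<delta>..\<delta>}"
      show "(?d has_derivative (\<lambda>u. u *\<^sub>R (w (g t) - w (h t)))) (at t within {-\<delta>..\<delta>})"
        unfolding has_vector_derivative_def[symmetric]
        by (intro has_vector_derivative_diff I w t)
      have "norm (w (g t) - w (h t)) \<le> K * dist (g t) (h t)"
        using lipschitz_onD[OF lip, of "g t" "h t"] by (simp add: dist_norm)
      also have "\<dots> \<le> K * dist g h"
        by (intro mult_left_mono dist_bounded K)
      finally show "onorm (\<lambda>u. u *\<^sub>R (w (g t) - w (h t))) \<le> K * dist g h"
        by (intro onorm_le) (simp add: mult.commute[of "K * _"] mult_left_mono)
    qed (use c \<delta> in auto)
    also have "\<dots> \<le> (K * dist g h) * \<delta>"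
      using c K by (intro mult_left_mono) auto
    finally show "dist (P g t) (P h t) \<le> (K * \<delta>) * dist g h"
      by (simp add: P c_def[symmetric] dist_norm I_def algebra_simps)
  qed
  then have "\<exists>!g. P g = g"
    using K \<delta> by (intro banach_fix_type[of "K * \<delta>"]) auto
  then obtain g where g: "P g = g"
    by blast
  have g_eq: "g t = z + I (\<lambda>t. w (apply_bcontfun g t)) t" if "t \<in> {-\<delta>..\<delta>}" for t
    using P[of g t] that by (simp add: g clamp_cancel_cbox)
  show thesis
  proof
    show "g 0 = z"
      using g_eq[of 0] \<delta> by (simp add: I_def)
    fix t assume t: "t \<in> {-\<delta><..<\<delta>}"
    have "((\<lambda>t. z + I (\<lambda>t. w (apply_bcontfun g t)) t) has_vector_derivative w (g t)) (at t within {-\<delta>..\<delta>})"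
      using I[OF w, of t g] t by (auto intro!: derivative_eq_intros)
    then have "((\<lambda>t. z + I (\<lambda>t. w (apply_bcontfun g t)) t) has_vector_derivative w (g t)) (at t)"
      using t by (simp add: at_within_Icc_at)
    then show "(g has_vector_derivative w (g t)) (at t)"
      by (rule has_vector_derivative_transform_within_open[OF _ _ t]) (auto simp: g_eq)
  qed
qed

text \<open>
  The existence time is the same for all initial values near \<open>p\<close>. The vector field is replaced
  by its composition with the nearest point projection onto a ball, which does not increase
  distances, hence is globally Lipschitz; for short times solutions cannot leave the ball, and
  there the two vector fields agree.
\<close>

lemma locally_uniform_existence:
  fixes v :: "'a::euclidean_space \<Rightarrow> 'a"
  assumes v: "C_class 1 v" and R: "R > 0"
  obtains \<delta> where "\<delta> > 0"
    "\<And>z t\<^sub>0. z \<in> ball p (R / 2) \<Longrightarrow> \<exists>\<xi>. ode_solution v {t\<^sub>0 - \<delta><..<t\<^sub>0 + \<delta>} \<xi> \<and> \<xi> t\<^sub>0 = z \<and>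
       \<xi> ` {t\<^sub>0 - \<delta><..<t\<^sub>0 + \<delta>} \<subseteq> cball p R"
proof -
  obtain K where lip: "K-lipschitz_on (cball p R) v"
    by (rule C_class_1_lipschitz_on[OF v compact_cball convex_cball])
  define w where "w y = v (closest_point (cball p R) y)" for y
  have proj: "closest_point (cball p R) y \<in> cball p R" for y
    using R by (intro closest_point_in_set) auto
  have lip_w: "K-lipschitz_on UNIV w"
  proof (rule lipschitz_onI)
    fix x y
    have "dist (w x) (w y) \<le> K * dist (closest_point (cball p R) x) (closest_point (cball p R) y)"
      unfolding w_def by (intro lipschitz_onD[OF lip] proj)
    also have "\<dots> \<le> K * dist x y"
      using R by (intro mult_left_mono closest_point_lipschitz lipschitz_on_nonneg[OF lip]) auto
    finally show "dist (w x) (w y) \<le> K * dist x y" .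
  qed (rule lipschitz_on_nonneg[OF lip])
  have "bounded (v ` cball p R)"
    by (intro compact_imp_bounded compact_continuous_image lipschitz_on_continuous_on[OF lip] compact_cball)
  then obtain M where M: "M > 0" "\<And>y. y \<in> cball p R \<Longrightarrow> norm (v y) \<le> M"
    by (auto simp: bounded_pos)
  \<comment> \<open>the first term makes the Picard operator contract, the second limits the travelled distance to \<open>R / 2\<close>\<close>
  define \<delta> where "\<delta> = min (1 / (K + 1)) (R / (2 * M))"
  have K: "K \<ge> 0"
    by (rule lipschitz_on_nonneg[OF lip])
  have "\<delta> > 0"
    using K M R by (simp add: \<delta>_def)
  moreover have "M * \<delta> \<le> M * (R / (2 * M))"
    using M by (intro mult_left_mono) (auto simp: \<delta>_def)
  then have "M * \<delta> \<le> R / 2"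
    using M by simp
  ultimately have \<delta>: "\<delta> > 0" "M * \<delta> \<le> R / 2" .
  have "K * \<delta> \<le> K * (1 / (K + 1))"
    using K by (intro mult_left_mono) (auto simp: \<delta>_def)
  also have "\<dots> < 1"
    using K by (simp add: field_simps)
  finally have K\<delta>: "K * \<delta> < 1" .
  show thesis
  proof
    fix z t\<^sub>0 assume z: "z \<in> ball p (R / 2)"
    obtain \<phi> where \<phi>: "\<phi> 0 = z" "\<And>t. t \<in> {-\<delta><..<\<delta>} \<Longrightarrow> (\<phi> has_vector_derivative w (\<phi> t)) (at t)"
      using picard_global_lipschitz[OF lip_w \<delta>(1) K\<delta>] by blast
    have stay: "\<phi> t \<in> cball p R" if t: "t \<in> {-\<delta><..<\<delta>}" for t
    proof -
      have "norm (\<phi> t - \<phi> 0) \<le> M * norm (t - 0)"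
      proof (rule differentiable_bound[of "{-\<delta><..<\<delta>}"])
        fix s assume "s \<in> {-\<delta><..<\<delta>}"
        then show "(\<phi> has_derivative (\<lambda>u. u *\<^sub>R w (\<phi> s))) (at s within {-\<delta><..<\<delta>})"
          using \<phi>(2) by (simp add: has_vector_derivative_def has_derivative_at_withinI)
        show "onorm (\<lambda>u. u *\<^sub>R w (\<phi> s)) \<le> M"
          using M(2)[OF proj] by (intro onorm_le) (simp add: w_def mult.commute[of M] mult_left_mono)
      qed (use t \<delta> in auto)
      also have "\<dots> \<le> M * \<delta>"
        using t M by (intro mult_left_mono) auto
      finally have "dist z (\<phi> t) \<le> R / 2"
        using \<delta>(2) by (simp add: \<phi>(1) dist_norm norm_minus_commute)
      then show ?thesis
        using z dist_triangle[of p "\<phi> t" z] by (simp add: dist_commute)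
    qed
    let ?J = "{t\<^sub>0 - \<delta><..<t\<^sub>0 + \<delta>}"
    have shift: "t - t\<^sub>0 \<in> {-\<delta><..<\<delta>}" if "t \<in> ?J" for t
      using that by auto
    have "((\<lambda>t. \<phi> (t - t\<^sub>0)) has_vector_derivative v (\<phi> (t - t\<^sub>0))) (at t)" if "t \<in> ?J" for t
    proof -
      have "(\<phi> has_vector_derivative v (\<phi> (t - t\<^sub>0))) (at (t - t\<^sub>0))"
        using \<phi>(2)[OF shift[OF that]] stay[OF shift[OF that]] by (simp add: w_def closest_point_self)
      then have "((\<phi> \<circ> (\<lambda>t. t - t\<^sub>0)) has_vector_derivative 1 *\<^sub>R v (\<phi> (t - t\<^sub>0))) (at t)"
        by (intro vector_diff_chain_at) (auto intro!: derivative_eq_intros)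
      then show ?thesis
        by (simp add: o_def)
    qed
    then have "ode_solution v ?J (\<lambda>t. \<phi> (t - t\<^sub>0))"
      by (auto simp: ode_solution_def is_interval_1)
    then show "\<exists>\<xi>. ode_solution v ?J \<xi> \<and> \<xi> t\<^sub>0 = z \<and> \<xi> ` ?J \<subseteq> cball p R"
      using stay shift \<phi>(1) by (intro exI[of _ "\<lambda>t. \<phi> (t - t\<^sub>0)"]) auto
  qed (rule \<delta>(1))
qed

section \<open>Uniqueness and maximal solutions\<close>

lemma ode_solution_continuous_on:
  "ode_solution v J \<phi> \<Longrightarrow> continuous_on J \<phi>"
  by (rule continuous_on_vector_derivative[where f' = "\<lambda>t. v (\<phi> t)"])
    (simp add: ode_solution_def has_vector_derivative_at_within)

lemma ode_solution_unique:
  fixes v :: "'a::euclidean_space \<Rightarrow> 'a"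
  assumes v: "C_class 1 v" and \<phi>: "ode_solution v J \<phi>" and \<psi>: "ode_solution v K \<psi>"
    and s: "s \<in> J \<inter> K" "\<phi> s = \<psi> s" and t: "t \<in> J \<inter> K"
  shows "\<phi> t = \<psi> t"
proof -
  let ?T = "closed_segment s t"
  have T: "?T \<subseteq> J" "?T \<subseteq> K"
    using s(1) t \<phi> \<psi> by (simp_all add: ode_solution_def is_interval_convex_1 closed_segment_subset)
  \<comment> \<open>both arcs lie in one ball, on which the vector field is Lipschitz\<close>
  have "compact (\<phi> ` ?T \<union> \<psi> ` ?T)"
    using T ode_solution_continuous_on[OF \<phi>] ode_solution_continuous_on[OF \<psi>]
    by (intro compact_Un compact_continuous_image) (auto intro: continuous_on_subset)
  then obtain R where R: "\<phi> ` ?T \<union> \<psi> ` ?T \<subseteq> cball 0 R"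
    using compact_imp_bounded[THEN bounded_iff[THEN iffD1]] by (force simp: subset_iff)
  obtain L where "L-lipschitz_on (cball 0 R) v"
    by (rule C_class_1_lipschitz_on[OF v compact_cball convex_cball])
  then have "norm (\<phi> t - \<psi> t) \<le> exp (L * \<bar>t - s\<bar>) * norm (\<phi> s - \<psi> s)"
  proof (rule solution_distance_le)
    show "is_interval ?T"
      by (simp add: is_interval_convex_1)
    fix \<tau> assume \<tau>: "\<tau> \<in> ?T"
    show "(\<phi> has_vector_derivative v (\<phi> \<tau>)) (at \<tau>)" "(\<psi> has_vector_derivative v (\<psi> \<tau>)) (at \<tau>)"
      using T \<tau> \<phi> \<psi> by (auto simp: ode_solution_def)
    show "\<phi> \<tau> \<in> cball 0 R" "\<psi> \<tau> \<in> cball 0 R"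
      using R \<tau> by blast+
  qed simp_all
  then show ?thesis
    using s(2) by simp
qed

lemma ode_solution_glue:
  fixes v :: "'a::euclidean_space \<Rightarrow> 'a"
  assumes v: "C_class 1 v" and \<phi>: "ode_solution v J \<phi>" and \<psi>: "ode_solution v K \<psi>"
    and s: "s \<in> J \<inter> K" "\<phi> s = \<psi> s"
  shows "ode_solution v (J \<union> K) (\<lambda>t. if t \<in> J then \<phi> t else \<psi> t)" (is "ode_solution _ _ ?\<xi>")
proof -
  have op: "open J" "open K"
    using \<phi> \<psi> by (auto simp: ode_solution_def)
  have "\<phi> t = \<psi> t" if "t \<in> J \<inter> K" for t
    using ode_solution_unique[OF v \<phi> \<psi> s that] .
  then have eq: "?\<xi> t = \<psi> t" if "t \<in> K" for t
    using that by auto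
  have "(?\<xi> has_vector_derivative v (?\<xi> t)) (at t)" if "t \<in> J \<union> K" for t
  proof (cases "t \<in> J")
    case True
    then have "(\<phi> has_vector_derivative v (\<phi> t)) (at t)"
      using \<phi> by (simp add: ode_solution_def)
    then have "(?\<xi> has_vector_derivative v (\<phi> t)) (at t)"
      by (rule has_vector_derivative_transform_within_open[OF _ op(1) True]) simp
    then show ?thesis
      using True by simp
  next
    case False
    with that have t: "t \<in> K"
      by simp
    then have "(\<psi> has_vector_derivative v (\<psi> t)) (at t)"
      using \<psi> by (simp add: ode_solution_def)
    then have "(?\<xi> has_vector_derivative v (\<psi> t)) (at t)"
      by (rule has_vector_derivative_transform_within_open[OF _ op(2) t]) (simp only: eq)
    then show ?thesis
      by (simp only: eq[OF t])
  qed
  moreover have "is_interval (J \<union> K)"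
    using \<phi> \<psi> s(1) by (auto simp: ode_solution_def is_interval_connected_1 intro!: connected_Un)
  ultimately show ?thesis
    using op by (simp add: ode_solution_def open_Un)
qed

lemma maximal_solution_extends:
  fixes v :: "'a::euclidean_space \<Rightarrow> 'a"
  assumes v: "C_class 1 v" and max: "maximal_solution v x J \<phi>" and \<psi>: "ode_solution v K \<psi>"
    and s: "s \<in> J \<inter> K" "\<phi> s = \<psi> s"
  shows "K \<subseteq> J"
proof -
  have glued: "ode_solution v (J \<union> K) (\<lambda>t. if t \<in> J then \<phi> t else \<psi> t)"
    using max by (intro ode_solution_glue[OF v _ \<psi>, of J \<phi> s] s) (simp add: maximal_solution_def)
  have max': "ode_solution v K \<psi> \<Longrightarrow> J \<subseteq> K \<Longrightarrow> \<forall>t\<in>J. \<psi> t = \<phi> t \<Longrightarrow> K = J" for K \<psi>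
    using max unfolding maximal_solution_def by blast
  have "J \<union> K = J"
    by (rule max'[OF glued]) simp_all
  then show ?thesis
    by blast
qed

text \<open>
  A maximal solution cannot be continued as a curve beyond the end of its interval, even if the
  continuation \<open>\<gamma>\<close> is only assumed to be continuous: near a time \<open>a\<close> at which \<open>\<gamma>\<close> is
  defined, solutions starting close to \<open>\<gamma> a\<close> live for a time \<open>\<delta>\<close> that does not depend on the
  starting point. So if \<open>J\<close> contains a time sufficiently close to \<open>a\<close>, it contains a whole
  neighbourhood of \<open>a\<close> in \<open>K\<close>. Thus \<open>J\<close> is open and closed relative to the connected set \<open>K\<close>.
\<close>

lemma maximal_solution_no_escape:
  fixes v :: "'a::euclidean_space \<Rightarrow> 'a"
  assumes v: "C_class 1 v" and max: "maximal_solution v x J \<phi>"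
    and K: "connected K" "0 \<in> K" and \<gamma>: "continuous_on K \<gamma>"
    and eq: "\<And>t. t \<in> J \<inter> K \<Longrightarrow> \<gamma> t = \<phi> t"
  shows "K \<subseteq> J"
proof
  fix t assume "t \<in> K"
  show "t \<in> J"
  proof (rule connected_induction_simple[where P = "\<lambda>t. t \<in> J", OF K(1) K(2) \<open>t \<in> K\<close>])
    show "0 \<in> J"
      using max by (simp add: maximal_solution_def)
    fix a assume a: "a \<in> K"
    obtain \<delta> where \<delta>: "\<delta> > 0"
      "\<And>z t\<^sub>0. z \<in> ball (\<gamma> a) (1 / 2) \<Longrightarrow> \<exists>\<xi>. ode_solution v {t\<^sub>0 - \<delta><..<t\<^sub>0 + \<delta>} \<xi> \<and> \<xi> t\<^sub>0 = z \<and>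
       \<xi> ` {t\<^sub>0 - \<delta><..<t\<^sub>0 + \<delta>} \<subseteq> cball (\<gamma> a) 1"
      using locally_uniform_existence[OF v zero_less_one] by blast
    let ?T = "K \<inter> \<gamma> -` ball (\<gamma> a) (1 / 2) \<inter> (K \<inter> ball a (\<delta> / 2))"
    have "openin (top_of_set K) ?T"
      by (intro openin_Int continuous_openin_preimage_gen[OF \<gamma>] openin_open_Int) auto
    moreover have "a \<in> ?T"
      using a \<delta>(1) by simp
    moreover have "r \<in> J" if sr: "s \<in> ?T" "r \<in> ?T" "s \<in> J" for s r
    proof -
      obtain \<xi> where \<xi>: "ode_solution v {s - \<delta><..<s + \<delta>} \<xi>" "\<xi> s = \<gamma> s"
        using \<delta>(2)[of "\<gamma> s" s] sr(1) by blast
      then have "{s - \<delta><..<s + \<delta>} \<subseteq> J"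
        using sr \<delta>(1) eq[of s] by (intro maximal_solution_extends[OF v max \<xi>(1), of s]) auto
      moreover have "dist s r < \<delta>"
        using sr dist_triangle_half_r[of a s \<delta> r] by (auto simp: dist_commute)
      ultimately show ?thesis
        by (auto simp: dist_real_def abs_less_iff subset_iff)
    qed
    ultimately show "\<exists>T. openin (top_of_set K) T \<and> a \<in> T \<and> (\<forall>s\<in>T. \<forall>r\<in>T. s \<in> J \<longrightarrow> r \<in> J)"
      by blast
  qed
qed

section \<open>Critical points of conserved quantities\<close>

text \<open>
  For short times the flow from time \<open>t\<close> to time \<open>s\<close> is a Lipschitz map that preserves \<open>L\<close> and
  sends \<open>\<phi> t\<close> to \<open>\<phi> s\<close>; pulling \<open>L\<close> back along it turns \<open>o(|k|)\<close> into \<open>o(|h|)\<close>. Around each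
  time \<open>a\<close> the estimate works for all \<open>s\<close> and \<open>t\<close> in one neighbourhood of \<open>a\<close>, and connectedness
  of \<open>J\<close> removes the restriction to short times.
\<close>

lemma critical_point_transport:
  fixes v :: "'a::euclidean_space \<Rightarrow> 'a" and L :: "'a \<Rightarrow> real"
  assumes v: "C_class 1 v" and cons: "conserved_quantity v L" and \<phi>: "ode_solution v J \<phi>"
    and s: "s \<in> J" "(L has_derivative (\<lambda>_. 0)) (at (\<phi> s))" and t: "t \<in> J"
  shows "(L has_derivative (\<lambda>_. 0)) (at (\<phi> t))"
proof -
  have con: "connected J"
    using \<phi> by (simp add: ode_solution_def is_interval_connected_1)
  show ?thesis
  proof (rule connected_induction_simple[where P = "\<lambda>t. (L has_derivative (\<lambda>_. 0)) (at (\<phi> t))",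
      OF con s(1) t s(2)])
    fix a assume a: "a \<in> J"
    define p where "p = \<phi> a"
    obtain K where lip: "K-lipschitz_on (cball p 1) v"
      by (rule C_class_1_lipschitz_on[OF v compact_cball convex_cball])
    have K: "K \<ge> 0"
      by (rule lipschitz_on_nonneg[OF lip])
    obtain \<delta> where \<delta>: "\<delta> > 0"
      "\<And>z t\<^sub>0. z \<in> ball p (1 / 2) \<Longrightarrow> \<exists>\<xi>. ode_solution v {t\<^sub>0 - \<delta><..<t\<^sub>0 + \<delta>} \<xi> \<and> \<xi> t\<^sub>0 = z \<and>
       \<xi> ` {t\<^sub>0 - \<delta><..<t\<^sub>0 + \<delta>} \<subseteq> cball p 1"
      using locally_uniform_existence[OF v zero_less_one] by blast
    have "open J"
      using \<phi> by (simp add: ode_solution_def)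
    then have "open (J \<inter> \<phi> -` ball p (1 / 2))"
      using continuous_open_preimage[OF ode_solution_continuous_on[OF \<phi>]] by simp
    moreover have "a \<in> J \<inter> \<phi> -` ball p (1 / 2)"
      using a by (simp add: p_def)
    ultimately obtain \<epsilon> where \<epsilon>: "\<epsilon> > 0" "ball a \<epsilon> \<subseteq> J \<inter> \<phi> -` ball p (1 / 2)"
      by (rule openE)
    \<comment> \<open>the half ensures that a solution started at one time of the neighbourhood reaches every other one\<close>
    define \<eta> where "\<eta> = min \<epsilon> (\<delta> / 2)"
    have T: "ball a \<eta> \<subseteq> J" "\<phi> ` ball a \<eta> \<subseteq> ball p (1 / 2)"
      using \<epsilon>(2) by (auto simp: \<eta>_def)
    have dist_T: "dist s t < \<delta>" if "s \<in> ball a \<eta>" "t \<in> ball a \<eta>" for s t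
      using that dist_triangle_half_r[of a s \<delta> t] by (auto simp: \<eta>_def)
    define C where "C = exp (K * \<delta>)"
    have C: "C > 0"
      by (simp add: C_def)
    have "(L has_derivative (\<lambda>_. 0)) (at (\<phi> t))"
      if st: "s \<in> ball a \<eta>" "t \<in> ball a \<eta>" and crit: "(L has_derivative (\<lambda>_. 0)) (at (\<phi> s))" for s t
      unfolding has_derivative_at_alt
    proof (intro conjI allI impI)
      fix e :: real assume "e > 0"
      then have "e / C > 0"
        using C by simp
      with crit obtain d where d: "d > 0"
        "\<And>y. norm (y - \<phi> s) < d \<Longrightarrow> \<bar>L y - L (\<phi> s)\<bar> \<le> e / C * norm (y - \<phi> s)"
        unfolding has_derivative_at_alt by auto
      have "\<phi> t \<in> ball p (1 / 2)"
        using T(2) st(2) by blast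
      then obtain r where r: "r > 0" "ball (\<phi> t) r \<subseteq> ball p (1 / 2)"
        using openE[OF open_ball] by blast
      have "\<bar>L z - L (\<phi> t)\<bar> \<le> e * norm (z - \<phi> t)" if z: "norm (z - \<phi> t) < min r (d / C)" for z
      proof -
        have "z \<in> ball p (1 / 2)"
          using r(2) z by (auto simp: dist_norm norm_minus_commute)
        \<comment> \<open>the perturbed solution: its value at time \<open>t\<close> is \<open>z\<close>, and it is compared with \<open>\<phi>\<close> at time \<open>s\<close>\<close>
        let ?I = "{t - \<delta><..<t + \<delta>}"
        obtain \<xi> where \<xi>: "ode_solution v ?I \<xi>" "\<xi> t = z" "\<xi> ` ?I \<subseteq> cball p 1"
          using \<delta>(2)[OF \<open>z \<in> ball p (1 / 2)\<close>] by blast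
        have I: "ball a \<eta> \<subseteq> ?I"
          using dist_T[OF st(2)] by (force simp: dist_real_def)
        have conv: "is_interval (ball a \<eta>)"
          by (simp add: is_interval_convex_1)
        have "norm (\<xi> s - \<phi> s) \<le> exp (K * \<bar>s - t\<bar>) * norm (\<xi> t - \<phi> t)"
        proof (rule solution_distance_le[OF lip conv])
          fix \<tau> assume \<tau>: "\<tau> \<in> ball a \<eta>"
          show "(\<xi> has_vector_derivative v (\<xi> \<tau>)) (at \<tau>)" "\<xi> \<tau> \<in> cball p 1"
            using \<xi> \<tau> I by (auto simp: ode_solution_def subset_iff image_subset_iff)
          show "(\<phi> has_vector_derivative v (\<phi> \<tau>)) (at \<tau>)"
            using \<phi> T(1) \<tau> by (auto simp: ode_solution_def)
          have "\<phi> \<tau> \<in> ball p (1 / 2)"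
            using T(2) \<tau> by blast
          then show "\<phi> \<tau> \<in> cball p 1"
            by simp
        qed (fact st)+
        also have "\<dots> \<le> C * norm (z - \<phi> t)"
          unfolding C_def \<xi>(2) using dist_T[OF st] K
          by (intro mult_right_mono iffD2[OF exp_le_cancel_iff] mult_left_mono) (auto simp: dist_real_def)
        finally have close: "norm (\<xi> s - \<phi> s) \<le> C * norm (z - \<phi> t)" .
        also have "\<dots> < d"
          using z C by (simp add: field_simps)
        finally have "\<bar>L (\<xi> s) - L (\<phi> s)\<bar> \<le> e / C * norm (\<xi> s - \<phi> s)"
          by (rule d(2))
        also have "\<dots> \<le> e / C * (C * norm (z - \<phi> t))"
          using close \<open>e / C > 0\<close> by (intro mult_left_mono) auto
        finally have "\<bar>L (\<xi> s) - L (\<phi> s)\<bar> \<le> e * norm (z - \<phi> t)"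
          using C by simp
        moreover have "L (\<phi> s) = L (\<phi> t)"
          using cons \<phi> T(1) st unfolding conserved_quantity_def by blast
        moreover have "L (\<xi> s) = L z"
          using cons \<xi>(1,2) I st unfolding conserved_quantity_def by (metis subsetD)
        ultimately show ?thesis
          by simp
      qed
      moreover have "min r (d / C) > 0"
        using r(1) d(1) C by simp
      ultimately show "\<exists>d>0. \<forall>y. norm (y - \<phi> t) < d \<longrightarrow> norm (L y - L (\<phi> t) - 0) \<le> e * norm (y - \<phi> t)"
        by (intro exI[of _ "min r (d / C)"]) simp
    qed simp
    moreover have "openin (top_of_set J) (ball a \<eta>)" "a \<in> ball a \<eta>"
      using T(1) \<epsilon>(1) \<delta>(1) by (auto simp: \<eta>_def intro: open_subset)
    ultimately show "\<exists>T. openin (top_of_set J) T \<and> a \<in> T \<and>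
        (\<forall>s\<in>T. \<forall>t\<in>T. (L has_derivative (\<lambda>_. 0)) (at (\<phi> s)) \<longrightarrow> (L has_derivative (\<lambda>_. 0)) (at (\<phi> t)))"
      by blast
  qed
qed

text \<open>
  The Riesz representation of the derivative supplies a gradient vector; its uniqueness is what
  makes the definite description in the definition of \<open>gradient\<close> meaningful.
\<close>

lemma GDERIV_gradient:
  fixes F :: "'a::euclidean_space \<Rightarrow> real"
  assumes "F differentiable (at y)"
  shows "GDERIV F y :> gradient F y"
proof -
  obtain F' where F': "(F has_derivative F') (at y)"
    using assms by (auto simp: differentiable_def)
  have "F' = (\<lambda>h. h \<bullet> adjoint F' 1)"
    using adjoint_works[OF has_derivative_linear[OF F'], of _ 1] by (simp add: fun_eq_iff)
  with F' have ex: "GDERIV F y :> adjoint F' 1"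
    unfolding gderiv_def by metis
  have "D = adjoint F' 1" if "GDERIV F y :> D" for D
  proof -
    have "(\<lambda>h. h \<bullet> D) = (\<lambda>h. h \<bullet> adjoint F' 1)"
      using that ex unfolding gderiv_def by (rule has_derivative_unique)
    then show ?thesis
      by (metis inner_commute vector_eq_rdot)
  qed
  with ex show ?thesis
    unfolding gradient_def by (rule theI)
qed

lemma gradient_eq_iff_critical:
  fixes F G :: "'a::euclidean_space \<Rightarrow> real"
  assumes "F differentiable (at y)" "G differentiable (at y)"
  shows "gradient F y = gradient G y \<longleftrightarrow> ((\<lambda>y. F y - G y) has_derivative (\<lambda>_. 0)) (at y)"
proof -
  have D: "((\<lambda>y. F y - G y) has_derivative (\<lambda>h. h \<bullet> (gradient F y - gradient G y))) (at y)"
    using GDERIV_diff[OF GDERIV_gradient[OF assms(1)] GDERIV_gradient[OF assms(2)]]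
    by (simp add: gderiv_def)
  show ?thesis
  proof
    assume "((\<lambda>y. F y - G y) has_derivative (\<lambda>_. 0)) (at y)"
    with D have "(\<lambda>h. h \<bullet> (gradient F y - gradient G y)) = (\<lambda>_. 0)"
      by (rule has_derivative_unique)
    then show "gradient F y = gradient G y"
      by (metis eq_iff_diff_eq_0 inner_eq_zero_iff)
  qed (use D in simp)
qed

section \<open>Two systems sharing a solution\<close>

theorem theorem3p1:
  fixes F G :: "real ^ 'n \<Rightarrow> real"
    and f :: "(real ^ 'n) \<times> (real ^ 'n) \<Rightarrow> real ^ 'n"
    and q :: nat
    and x :: "real ^ 'n"
    and J\<^sub>F J\<^sub>G :: "real set"
    and \<Phi>\<^sub>F \<Phi>\<^sub>G :: "real \<Rightarrow> real ^ 'n"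
  assumes "q \<ge> 1"
    and "C_class q F" and "C_class q G" and "C_class q f"
    and "C_class 1 (\<lambda>y. f (y, gradient F y))"
    and "C_class 1 (\<lambda>y. f (y, gradient G y))"
    and "maximal_solution (\<lambda>y. f (y, gradient F y)) x J\<^sub>F \<Phi>\<^sub>F"
    and "maximal_solution (\<lambda>y. f (y, gradient G y)) x J\<^sub>G \<Phi>\<^sub>G"
    and "conserved_quantity (\<lambda>y. f (y, gradient F y)) (\<lambda>y. F y - G y)"
    and "x \<in> {y. gradient F y = gradient G y}"
  shows "J\<^sub>F = J\<^sub>G \<and> (\<forall>t\<in>J\<^sub>F. \<Phi>\<^sub>F t = \<Phi>\<^sub>G t)"
proof -
  let ?v = "\<lambda>y. f (y, gradient F y)" and ?w = "\<lambda>y. f (y, gradient G y)"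
  obtain k where "q = Suc k"
    using \<open>q \<ge> 1\<close> by (cases q) auto
  then have diff: "F differentiable (at y)" "G differentiable (at y)" for y
    using assms(2,3) by auto
  note crit = gradient_eq_iff_critical[OF diff]
  have sol: "ode_solution ?v J\<^sub>F \<Phi>\<^sub>F" "ode_solution ?w J\<^sub>G \<Phi>\<^sub>G"
    and zero: "0 \<in> J\<^sub>F" "\<Phi>\<^sub>F 0 = x" "0 \<in> J\<^sub>G" "\<Phi>\<^sub>G 0 = x"
    using assms(7,8) by (auto simp: maximal_solution_def)
  have "gradient F (\<Phi>\<^sub>F t) = gradient G (\<Phi>\<^sub>F t)" if "t \<in> J\<^sub>F" for t
    using critical_point_transport[OF assms(5,9) sol(1) zero(1) _ that] assms(10)
    by (simp add: crit zero(2))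
  then have sol': "ode_solution ?w J\<^sub>F \<Phi>\<^sub>F"
    using sol(1) by (simp add: ode_solution_def)
  have "\<Phi>\<^sub>F 0 = \<Phi>\<^sub>G 0"
    by (simp add: zero)
  then have eq: "\<Phi>\<^sub>F t = \<Phi>\<^sub>G t" if "t \<in> J\<^sub>F \<inter> J\<^sub>G" for t
    using ode_solution_unique[OF assms(6) sol' sol(2) _ _ that] zero by blast
  have "J\<^sub>F \<subseteq> J\<^sub>G"
    using zero by (intro maximal_solution_extends[OF assms(6,8) sol', of 0]) auto
  moreover have "J\<^sub>G \<subseteq> J\<^sub>F"
  proof (rule maximal_solution_no_escape[OF assms(5,7)])
    show "connected J\<^sub>G"
      using sol(2) by (simp add: ode_solution_def is_interval_connected_1)
    show "continuous_on J\<^sub>G \<Phi>\<^sub>G"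
      by (rule ode_solution_continuous_on[OF sol(2)])
  qed (use zero eq in auto)
  ultimately show ?thesis
    using eq by blast
qed

end
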